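(* Let $G$ and $H$ be connected graphs, each with $n$ vertices $\{1,2,\ldots,n\}$ and $m$ edges, with edge sets $E(G),E(H)$ and Laplacian matrices $L_G,L_H$. Let $\tau:E(G)\to E(H)$ be a 2-isomorphism and let $U_\tau$ be an $n\times n$ unimodular matrix such that $U_\tau L_G U_\tau^T=L_H$ and $U_\tau$ is compatible with $\tau$. Suppose $(a,b)$ is an edge in $G$ and $\tau(a,b)=(c,d)$ is the corresponding edge in $H$. Then $$\mathrm{Harm}(G,\{a,b\})=\mathrm{Harm}(H,\{c,d\})\,U_\tau,$$ where $\mathrm{Harm}(H,\{c,d\})\,U_\tau=\{uU_\tau : u\in \mathrm{Harm}(H,\{c,d\})\}$.
   Context: Graphs are finite, with unweighted edges, no loops and no multiple edges; $E(G)$ denotes the edge set of $G$, and an edge with ends $a,b$ is written $(a,b)$. Vectors in $\mathbb{R}^n$ are row vectors, and $e_a$ denotes the $a$-th standard basis row vector. A unimodular matrix is a square integer matrix with determinant $\pm 1$. Laplacian: for a graph $G$ on vertices $\{1,\ldots,n\}$, $L_G$ is the $n\times n$ matrix with $(L_G)_{a,a}=d_a$ (the degree of vertex $a$) and, for $a\neq b$, $(L_G)_{a,b}=-1$ if $(a,b)\in E(G)$ and $(L_G)_{a,b}=0$ otherwise. 2-isomorphism: a bijection $\tau:E(G)\to E(H)$ is a 2-isomorphism if a subset $S\subseteq E(G)$ forms a cycle in $G$ (is the edge set of a cycle) if and only if $\tau(S)$ forms a cycle in $H$. Compatible: a unimodular matrix $U_\tau$ with $U_\tau L_G U_\tau^T=L_H$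 is compatible with $\tau$ if for every edge $(a,b)\in E(G)$ one has $U_\tau(e_a-e_b)^T=(e_c-e_d)^T$ where $(c,d)=\tau(a,b)$. Here the two ends of the edge $\tau(a,b)$ are listed in a suitable order $(c,d)$; i.e. if $c,d$ are the ends of the image edge, then $U_\tau(e_a-e_b)^T$ equals $(e_c-e_d)^T$ or $(e_d-e_c)^T$. Harmonic vectors: for $\mathcal{A}\subseteq\{1,\ldots,n\}$, let $$W(\mathcal{A})=\Big\{u=(u_1,\ldots,u_n)\in\mathbb{R}^n: u_i=0 \text{ for } i\notin\mathcal{A} \text{ and } \sum_{i=1}^n u_i=0\Big\},$$ and $\mathrm{Harm}(G,\mathcal{A})=\{v\in\mathbb{R}^n : vL_G\in W(\mathcal{A})\}$; $\mathrm{Harm}(H,\mathcal{C})$, for $\mathcal{C}\subseteq\{1,\ldots,n\}$, is defined in the same way using $L_H$. *)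

theory Defs
  imports "HOL-Analysis.Analysis"
begin

text \<open>
  A graph on the vertex set \<^term>\<open>UNIV :: 'n::finite set\<close> is given by its set of edges;
  the edge with ends \<open>a\<close> and \<open>b\<close> is the unordered pair \<open>{a, b}\<close>.
  The finite type \<open>'n\<close> plays the role of \<open>{1, ..., n}\<close>.
\<close>

definition simple_graph :: "'n::finite set set \<Rightarrow> bool" where
  "simple_graph E \<longleftrightarrow> (\<forall>e\<in>E. card e = 2)"

definition connected_graph :: "'n::finite set set \<Rightarrow> bool" where
  "connected_graph E \<longleftrightarrow> (\<forall>u v. (u, v) \<in> {(x, y). {x, y} \<in> E}\<^sup>*)"

definition degree :: "'n::finite set set \<Rightarrow> 'n \<Rightarrow> nat" where
  "degree E a = card {e \<in> E. a \<in> e}"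

definition laplacian :: "'n::finite set set \<Rightarrow> real^'n^'n" where
  "laplacian E = (\<chi> a b. if a = b then real (degree E a)
                         else if {a, b} \<in> E then -1 else 0)"

definition forms_cycle :: "'n::finite set set \<Rightarrow> 'n set set \<Rightarrow> bool" where
  "forms_cycle E S \<longleftrightarrow> S \<subseteq> E \<and>
     (\<exists>xs. distinct xs \<and> length xs \<ge> 3 \<and>
           S = {{xs ! i, xs ! (Suc i mod length xs)} | i. i < length xs})"

definition two_isomorphism ::
  "('n::finite set \<Rightarrow> 'n set) \<Rightarrow> 'n set set \<Rightarrow> 'n set set \<Rightarrow> bool" where
  "two_isomorphism \<tau> E F \<longleftrightarrow>
     bij_betw \<tau> E F \<and> (\<forall>S\<subseteq>E. forms_cycle E S \<longleftrightarrow> forms_cycle F (\<tau> ` S))"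

definition unimodular :: "real^'n^'n::finite \<Rightarrow> bool" where
  "unimodular U \<longleftrightarrow> (\<forall>i j. U $ i $ j \<in> \<int>) \<and> (det U = 1 \<or> det U = -1)"

text \<open>
  The existential over \<open>c\<close> and \<open>d\<close> lets the ends of the image edge be listed in either order.
  Multiplying by a column vector from the right is \<open>(*v)\<close>, so no transposes are needed.
\<close>

definition compatible ::
  "real^'n^'n::finite \<Rightarrow> ('n set \<Rightarrow> 'n set) \<Rightarrow> 'n set set \<Rightarrow> bool" where
  "compatible U \<tau> E \<longleftrightarrow>
     (\<forall>a b. {a, b} \<in> E \<longrightarrow>
        (\<exists>c d. \<tau> {a, b} = {c, d} \<and>
               U *v (axis a 1 - axis b 1) = axis c 1 - axis d 1))"

definition W :: "'n::finite set \<Rightarrow> (real^'n) set" where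
  "W A = {u. (\<forall>i. i \<notin> A \<longrightarrow> u $ i = 0) \<and> (\<Sum>i\<in>UNIV. u $ i) = 0}"

definition Harm :: "'n::finite set set \<Rightarrow> 'n set \<Rightarrow> (real^'n) set" where
  "Harm E A = {v. v v* laplacian E \<in> W A}"

end

theory Submission
  imports Defs
begin

text \<open>
  \<open>W {a, b}\<close> is the line spanned by \<open>e\<^sub>a - e\<^sub>b\<close>, so compatibility makes \<open>U\<close> map it onto
  \<open>W {c, d}\<close>. Since \<open>u L\<^sub>H = (u U) L\<^sub>G U\<^sup>T\<close>, a vector \<open>u\<close> is harmonic for \<open>H\<close> iff \<open>u U\<close> is
  harmonic for \<open>G\<close>, and every vector is of the form \<open>u U\<close> because \<open>U\<close> is invertible.
\<close>

lemma W_pair: "W {a, b} = range (\<lambda>t. t *\<^sub>R (axis a 1 - axis b 1 :: real^'n::finite))"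
proof (intro set_eqI iffI)
  fix u :: "real^'n"
  assume u: "u \<in> W {a, b}"
  have "sum (($) u) {a, b} = sum (($) u) UNIV"
    using u by (intro sum.mono_neutral_left) (auto simp: W_def)
  then have "sum (($) u) {a, b} = 0"
    using u by (simp add: W_def)
  \<comment> \<open>The zero sum forces \<open>u $ b = - u $ a\<close>; if \<open>a = b\<close>, it
    forces \<open>u = 0\<close>.\<close>
  then have "u = (u $ a) *\<^sub>R (axis a 1 - axis b 1)"
    using u by (cases "a = b") (auto simp: W_def vec_eq_iff axis_def)
  then show "u \<in> range (\<lambda>t. t *\<^sub>R (axis a 1 - axis b 1))"
    by blast
qed (auto simp: W_def axis_def sum_subtractf simp flip: sum_distrib_left)

text \<open>Linearity carries one line onto the other; injectivity keeps vectors outside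
  \<open>W {a, b}\<close> from landing in \<open>W {c, d}\<close>.\<close>

lemma matrix_vector_mult_mem_W_iff:
  fixes U :: "real^'n::finite^'n"
  assumes "inj ((*v) U)" and "U *v (axis a 1 - axis b 1) = axis c 1 - axis d 1"
  shows "U *v w \<in> W {c, d} \<longleftrightarrow> w \<in> W {a, b}"
proof -
  have "W {c, d} = (*v) U ` W {a, b}"
    by (simp add: W_pair image_image matrix_vector_mult_scaleR assms(2))
  then show ?thesis
    using assms(1) by (simp add: inj_image_mem_iff)
qed

lemma mem_Harm_congruent_iff:
  fixes U :: "real^'n::finite^'n"
  assumes "inj ((*v) U)" and "U *v (axis a 1 - axis b 1) = axis c 1 - axis d 1"
    and "U ** laplacian E ** transpose U = laplacian F"
  shows "u \<in> Harm F {c, d} \<longleftrightarrow> u v* U \<in> Harm E {a, b}"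
proof -
  \<comment> \<open>Multiplying a row vector by \<open>transpose U\<close> is the same as applying
    \<open>U\<close> to it as a column.\<close>
  have "u v* laplacian F = U *v (u v* U v* laplacian E)"
    by (metis assms(3) vector_matrix_mul_assoc vector_transpose_matrix)
  then show ?thesis
    by (simp add: Harm_def matrix_vector_mult_mem_W_iff[OF assms(1,2)])
qed

theorem corollary1:
  fixes E F :: "'n::finite set set"
    and m :: nat
    and \<tau> :: "'n set \<Rightarrow> 'n set"
    and U :: "real^'n^'n"
    and a b c d :: 'n
  assumes "simple_graph E" and "simple_graph F"
    and "connected_graph E" and "connected_graph F"
    and "card E = m" and "card F = m"
    and "two_isomorphism \<tau> E F"
    and "unimodular U"
    and "U ** laplacian E ** transpose U = laplacian F"
    and "compatible U \<tau> E"
    and "{a, b} \<in> E" and "\<tau> {a, b} = {c, d}"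
  shows "Harm E {a, b} = {u v* U | u. u \<in> Harm F {c, d}}"
proof -
  obtain c' d' where cd: "\<tau> {a, b} = {c', d'}"
    and U_edge: "U *v (axis a 1 - axis b 1) = axis c' 1 - axis d' 1"
    using assms(10,11) unfolding compatible_def by blast
  have "invertible U"
    using assms(8) by (auto simp: unimodular_def invertible_det_nz)
  then obtain V where UV: "U ** V = mat 1" "V ** U = mat 1"
    unfolding invertible_def by blast
  have "inj ((*v) U)"
    using UV(2) by (metis injI matrix_vector_mul_assoc matrix_vector_mul_lid)
  \<comment> \<open>\<open>c'\<close> and \<open>d'\<close> may be \<open>c\<close> and
    \<open>d\<close> swapped, but \<open>Harm\<close> sees only the unordered pair.\<close>
  from mem_Harm_congruent_iff[OF this U_edge assms(9)] cd assms(12)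
  have Harm_iff: "u \<in> Harm F {c, d} \<longleftrightarrow> u v* U \<in> Harm E {a, b}" for u
    by simp
  \<comment> \<open>This supplies the witness \<open>u = v v* V\<close> for the inclusion from left
    to right.\<close>
  have "v = v v* V v* U" for v
    by (simp add: vector_matrix_mul_assoc UV(2))
  then show ?thesis
    using Harm_iff by auto metis
qed

end
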